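(* Let $\mathbb{X}$ be a finite-dimensional polyhedral real Banach space and let $f\in S_{\mathbb{X}^*}$. Then the following are equivalent: (i) $f$ is an extreme contraction, i.e. $f$ is an extreme point of the closed unit ball of $\mathbb{X}^*$. (ii) There exists $\epsilon_0>0$ such that for each $0<\epsilon<\epsilon_0$, $f$ does not admit a non-trivial uniform $\epsilon$-BPB approximation. (iii) For any $\epsilon>0$, $f$ admits a uniform $\epsilon$-BPB approximation which is an extreme contraction.
   Context: A finite-dimensional Banach space is polyhedral if its closed unit ball has only finitely many extreme points. $S_Z$ is the unit sphere of a normed space $Z$. For $g\in\mathbb{X}^*$, $M_g=\{x\in S_{\mathbb{X}}:|g(x)|=\|g\|\}$. For $f\in S_{\mathbb{X}^*}$ and $\epsilon>0$, a functional $g\in S_{\mathbb{X}^*}$ is a uniform $\epsilon$-BPB approximation of $f$ if $\|f-g\|<\epsilon$ and there exists $\delta(\epsilon)>0$ such that for each $x_0\in S_{\mathbb{X}}$ with $|f(x_0)|>1-\delta(\epsilon)$ there exists $u_0\in M_g$ with $\|u_0-x_0\|<\epsilon$. It is non-trivial if in addition $g\neq f$. *)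

theory Defs
  imports "HOL-Analysis.Analysis"
begin

text \<open>
  The dual of a real normed space \<open>'a\<close> is the type \<open>'a \<Rightarrow>\<^sub>L real\<close> of bounded linear
  functionals with the operator norm. Properties of a space are stated for the whole type, which is
  passed as \<open>TYPE('a)\<close>.
\<close>

definition finite_dimensional_space :: "'a::real_normed_vector itself \<Rightarrow> bool" where
  "finite_dimensional_space _ \<longleftrightarrow> (\<exists>B :: 'a set. finite B \<and> span B = UNIV)"

definition polyhedral_space :: "'a::real_normed_vector itself \<Rightarrow> bool" where
  "polyhedral_space _ \<longleftrightarrow> finite {x :: 'a. x extreme_point_of cball 0 1}"

definition norm_attainment_set :: "('a::real_normed_vector \<Rightarrow>\<^sub>L real) \<Rightarrow> 'a set" where
  "norm_attainment_set g = {x \<in> sphere 0 1. \<bar>blinfun_apply g x\<bar> = norm g}"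

definition extreme_contraction :: "('a::real_normed_vector \<Rightarrow>\<^sub>L real) \<Rightarrow> bool" where
  "extreme_contraction f \<longleftrightarrow> f extreme_point_of cball 0 1"

definition uniform_BPB_approximation ::
    "real \<Rightarrow> ('a::real_normed_vector \<Rightarrow>\<^sub>L real) \<Rightarrow> ('a \<Rightarrow>\<^sub>L real) \<Rightarrow> bool" where
  "uniform_BPB_approximation \<epsilon> f g \<longleftrightarrow>
     g \<in> sphere 0 1 \<and> norm (f - g) < \<epsilon> \<and>
     (\<exists>\<delta>>0. \<forall>x\<^sub>0 \<in> sphere 0 1. \<bar>blinfun_apply f x\<^sub>0\<bar> > 1 - \<delta> \<longrightarrow>
        (\<exists>u\<^sub>0 \<in> norm_attainment_set g. norm (u\<^sub>0 - x\<^sub>0) < \<epsilon>))"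

definition nontrivial_uniform_BPB_approximation ::
    "real \<Rightarrow> ('a::real_normed_vector \<Rightarrow>\<^sub>L real) \<Rightarrow> ('a \<Rightarrow>\<^sub>L real) \<Rightarrow> bool" where
  "nontrivial_uniform_BPB_approximation \<epsilon> f g \<longleftrightarrow> uniform_BPB_approximation \<epsilon> f g \<and> g \<noteq> f"

end

theory Submission
  imports Defs
begin

text \<open>
  On a finite-dimensional space every functional attains its maximum over a compact convex set at an
  extreme point. Hence functionals are controlled by their values on the finite set \<open>E\<close> of
  extreme points of the ball, and only finitely many sets \<open>M\<^sub>g\<close> occur. So for small \<open>\<epsilon>\<close>
  a uniform \<open>\<epsilon>\<close>-BPB approximation \<open>g\<close> of \<open>f\<close> agrees with \<open>f\<close> on \<open>E \<inter> M\<^sub>f\<close>; if \<open>f\<close>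
  is extreme, this forces \<open>g = f\<close>, because otherwise \<open>f \<plusminus> t (g - f)\<close> stays in the ball for small
  \<open>t\<close>. By compactness \<open>f\<close> is always a uniform approximation of itself. If \<open>f\<close> is a proper convex
  combination of \<open>a\<close> and \<open>b\<close>, then both agree with \<open>f\<close> on \<open>M\<^sub>f\<close>, so a functional
  slightly moved from \<open>f\<close> towards \<open>b\<close> still attains its norm on \<open>M\<^sub>f\<close> and is a non-trivial approximation. Finally, an extreme functional is
  determined by its signs on \<open>E\<close>, so there are finitely many, and a limit of them is extreme.
\<close>

section \<open>Compactness and extreme points in finite dimension\<close>

text \<open>The library's \<open>separate_point_closed\<close> requires the class \<open>heine_borel\<close>.\<close>

lemma closed_imp_pos_dist:
  fixes S :: "'a::metric_space set"
  assumes "closed S" "a \<notin> S"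
  shows "\<exists>d>0. \<forall>x\<in>S. d \<le> dist a x"
proof -
  obtain d where "d > 0" "ball a d \<subseteq> - S"
    using assms open_contains_ball[of "- S"] by (auto simp: open_Compl)
  then show ?thesis
    by (intro exI[of _ d]) (auto simp: subset_iff not_less[symmetric])
qed

text \<open>Adding a vector \<open>a\<close> turns the set into a Minkowski sum of the box over
  \<open>B\<close> and a continuous image of \<open>I a\<close>, so compactness follows by
  induction. The sets \<open>I b\<close> vary with \<open>b\<close> so that a single coefficient can
  be frozen while the others range over an interval.\<close>

lemma compact_coefficient_box:
  fixes B :: "'a::real_normed_vector set"
  assumes "finite B" "\<And>b. b \<in> B \<Longrightarrow> compact (I b)"
  shows "compact {\<Sum>b\<in>B. c b *\<^sub>R b | c. \<forall>b\<in>B. c b \<in> I b}"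
  using assms
proof (induction B)
  case empty
  have "{\<Sum>b\<in>{}. c b *\<^sub>R b | c. \<forall>b\<in>{}. c b \<in> I b} = {0::'a}"
    by auto
  then show ?case by simp
next
  case (insert a B)
  let ?S = "{\<Sum>b\<in>B. c b *\<^sub>R b | c. \<forall>b\<in>B. c b \<in> I b}"
  let ?T = "(\<lambda>t. t *\<^sub>R a) ` I a"
  have "compact ?T"
    using insert.prems by (intro compact_continuous_image continuous_intros) auto
  moreover have "compact ?S"
    using insert by blast
  moreover have "{\<Sum>b\<in>insert a B. c b *\<^sub>R b | c. \<forall>b\<in>insert a B. c b \<in> I b}
      = {x + y | x y. x \<in> ?T \<and> y \<in> ?S}" (is "?L = ?R")
  proof
    show "?L \<subseteq> ?R"
      using insert.hyps by auto
    show "?R \<subseteq> ?L"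
    proof
      fix z assume "z \<in> ?R"
      then obtain t c where tc: "t \<in> I a" "\<forall>b\<in>B. c b \<in> I b"
        "z = t *\<^sub>R a + (\<Sum>b\<in>B. c b *\<^sub>R b)"
        by blast
      have "(\<Sum>b\<in>B. (c(a := t)) b *\<^sub>R b) = (\<Sum>b\<in>B. c b *\<^sub>R b)"
        using insert.hyps by (intro sum.cong) auto
      then have "z = (\<Sum>b\<in>insert a B. (c(a := t)) b *\<^sub>R b)"
        using insert.hyps tc by simp
      moreover have "\<forall>b\<in>insert a B. (c(a := t)) b \<in> I b"
        using tc by simp
      ultimately show "z \<in> ?L"
        by blast
    qed
  qed
  ultimately show ?case
    by (simp only: compact_sums)
qed

text \<open>\<open>K 1 a\<close> is the image of the face of the coefficient cube on which
  coordinate \<open>a\<close> equals 1. The union of these images is compact and, by independence,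
  misses 0; \<open>d\<close> is a lower bound for its distance to 0.\<close>

lemma independent_coefficients_bounded:
  fixes B :: "'a::real_normed_vector set"
  assumes "finite B" "independent B"
  obtains d where "d > 0" "\<And>c b. b \<in> B \<Longrightarrow> d * \<bar>c b\<bar> \<le> norm (\<Sum>b\<in>B. c b *\<^sub>R b)"
proof -
  define K where "K s a = {\<Sum>b\<in>B. c b *\<^sub>R b | c. \<forall>b\<in>B. c b \<in> (if b = a then {s} else {-1..1})}"
    for s :: real and a
  have "\<exists>d>0. \<forall>x\<in>(\<Union>a\<in>B. K 1 a). d \<le> dist 0 x"
  proof (rule closed_imp_pos_dist)
    show "closed (\<Union>a\<in>B. K 1 a)"
      unfolding K_def using assms(1)
      by (intro compact_imp_closed compact_UN compact_coefficient_box) auto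
    have "0 \<notin> K 1 a" if "a \<in> B" for a
    proof
      assume "0 \<in> K 1 a"
      then obtain c where c: "(\<Sum>b\<in>B. c b *\<^sub>R b) = 0"
        "\<forall>b\<in>B. c b \<in> (if b = a then {1} else {-1..1})"
        unfolding K_def by auto
      then have "c a = 0"
        using assms that independentD by blast
      then show False
        using c that by auto
    qed
    then show "0 \<notin> (\<Union>a\<in>B. K 1 a)"
      by blast
  qed
  then obtain d where d: "d > 0" "\<And>a x. a \<in> B \<Longrightarrow> x \<in> K 1 a \<Longrightarrow> d \<le> norm x"
    by auto
  have "d * \<bar>c b\<bar> \<le> norm (\<Sum>b\<in>B. c b *\<^sub>R b)" if b: "b \<in> B" for c b
  proof -
    define m where "m = Max ((\<lambda>b. \<bar>c b\<bar>) ` B)"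
    have m: "\<bar>c b\<bar> \<le> m" if "b \<in> B" for b
      using that assms(1) by (auto simp: m_def)
    have "m \<in> (\<lambda>b. \<bar>c b\<bar>) ` B"
      unfolding m_def using assms(1) b by (intro Max_in) auto
    then obtain a where a: "a \<in> B" "m = \<bar>c a\<bar>"
      by auto
    show ?thesis
    proof (cases "c a = 0")
      case True
      then show ?thesis using m[OF b] a by simp
    next
      case False
      \<comment> \<open>Dividing by the coefficient of largest modulus makes it 1 and puts all the
        others into [-1,1].\<close>
      have "(\<Sum>b\<in>B. (c b / c a) *\<^sub>R b) \<in> K 1 a"
        unfolding K_def using False m a
        by (auto simp: divide_le_eq le_divide_eq abs_le_iff intro!: exI[of _ "\<lambda>b. c b / c a"])
          (smt (verit) m)+
      then have "d \<le> norm (\<Sum>b\<in>B. (c b / c a) *\<^sub>R b)"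
        using d a by blast
      also have "(\<Sum>b\<in>B. (c b / c a) *\<^sub>R b) = (1 / c a) *\<^sub>R (\<Sum>b\<in>B. c b *\<^sub>R b)"
        by (simp add: scaleR_sum_right)
      finally have "d * \<bar>c a\<bar> \<le> norm (\<Sum>b\<in>B. c b *\<^sub>R b)"
        using False by (simp add: field_simps)
      moreover have "d * \<bar>c b\<bar> \<le> d * \<bar>c a\<bar>"
        using d m[OF b] a by simp
      ultimately show ?thesis by linarith
    qed
  qed
  with d that show ?thesis by blast
qed

lemma finite_dimensional_basis:
  assumes "finite_dimensional_space TYPE('a)"
  obtains B :: "'a::real_normed_vector set" where "finite B" "independent B" "span B = UNIV"
proof -
  obtain C :: "'a set" where C: "finite C" "span C = UNIV"
    using assms unfolding finite_dimensional_space_def by blast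
  obtain B where "B \<subseteq> C" "independent B" "C \<subseteq> span B"
    using maximal_independent_subset by blast
  then show ?thesis
    using that C by (metis finite_subset span_mono span_span top.extremum_unique)
qed

text \<open>The coefficient bound encloses the ball in a compact coefficient box, of which it is a
  closed subset.\<close>

lemma finite_dimensional_compact_cball:
  assumes "finite_dimensional_space TYPE('a::real_normed_vector)"
  shows "compact (cball (0::'a) 1)"
proof -
  obtain B :: "'a set" where B: "finite B" "independent B" "span B = UNIV"
    using finite_dimensional_basis[OF assms] .
  obtain d where d: "d > 0" "\<And>c b. b \<in> B \<Longrightarrow> d * \<bar>c b\<bar> \<le> norm (\<Sum>b\<in>B. c b *\<^sub>R b)"
    using independent_coefficients_bounded[OF B(1,2)] by blast
  let ?K = "{\<Sum>b\<in>B. c b *\<^sub>R b | c. \<forall>b\<in>B. c b \<in> {-(1/d)..1/d}}"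
  have "cball 0 1 \<subseteq> ?K"
  proof
    fix x :: 'a assume x: "x \<in> cball 0 1"
    define c where "c = representation B x"
    have eq: "x = (\<Sum>b\<in>B. c b *\<^sub>R b)"
      unfolding c_def using B by (simp add: real_vector.sum_representation_eq)
    have "\<bar>c b\<bar> \<le> 1 / d" if "b \<in> B" for b
    proof -
      have "d * \<bar>c b\<bar> \<le> 1"
        using d(2)[OF that, of c] x eq by simp
      then show ?thesis
        using d(1) by (simp add: field_simps)
    qed
    then show "x \<in> ?K"
      using eq by (auto simp: abs_le_iff minus_le_iff intro!: exI[of _ c])
  qed
  moreover have "compact ?K"
    by (intro compact_coefficient_box B) auto
  ultimately show ?thesis
    using compact_Int_closed[of ?K "cball 0 1"] by (simp add: Int_absorb1)
qed

text \<open>The coordinate functionals of a basis serve as \<open>K\<close>; the coefficient bound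
  makes each of them continuous, with norm at most \<open>1 / d\<close>.\<close>

lemma finite_dimensional_separating_functionals:
  assumes "finite_dimensional_space TYPE('a)"
  obtains K :: "('a::real_normed_vector \<Rightarrow>\<^sub>L real) set"
    where "finite K" "\<And>x y. (\<And>k. k \<in> K \<Longrightarrow> k x = k y) \<Longrightarrow> x = y"
proof -
  obtain B :: "'a set" where B: "finite B" "independent B" "span B = UNIV"
    using finite_dimensional_basis[OF assms] .
  obtain d where d: "d > 0" "\<And>c b. b \<in> B \<Longrightarrow> d * \<bar>c b\<bar> \<le> norm (\<Sum>b\<in>B. c b *\<^sub>R b)"
    using independent_coefficients_bounded[OF B(1,2)] by blast
  have sum_rep: "(\<Sum>b\<in>B. representation B x b *\<^sub>R b) = x" for x
    using B by (simp add: real_vector.sum_representation_eq)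
  have lin: "bounded_linear (\<lambda>x. representation B x b)" if "b \<in> B" for b
  proof (rule bounded_linear_intro)
    show "norm (representation B x b) \<le> norm x * (1 / d)" for x
      using d(2)[OF that, of "representation B x"] d(1) sum_rep[of x]
      by (simp add: field_simps)
  qed (use B in \<open>simp_all add: real_vector.representation_add real_vector.representation_scale\<close>)
  define K where "K = (\<lambda>b. Blinfun (\<lambda>x. representation B x b)) ` B"
  show ?thesis
  proof
    show "finite K"
      using B by (simp add: K_def)
    fix x y :: 'a assume "\<And>k. k \<in> K \<Longrightarrow> k x = k y"
    then have "representation B x b = representation B y b" if "b \<in> B" for b
      using that lin[OF that] bounded_linear_Blinfun_apply by (fastforce simp: K_def)
    then show "x = y"
      using sum_rep[of x] sum_rep[of y] by (metis (no_types, lifting) sum.cong)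
  qed
qed

section \<open>Faces cut out by functionals\<close>

lemma face_of_functional_max:
  fixes k :: "'a::real_normed_vector \<Rightarrow>\<^sub>L real"
  assumes "convex S" "\<And>y. y \<in> S \<Longrightarrow> k y \<le> m"
  shows "{y \<in> S. k y = m} face_of S"
  unfolding face_of_def
proof (intro conjI ballI impI)
  show "convex {y \<in> S. k y = m}"
    using assms(1)
    by (auto simp: convex_def blinfun.add_right blinfun.scaleR_right simp flip: distrib_right)
  fix a b x
  assume ab: "a \<in> S" "b \<in> S" and x: "x \<in> {y \<in> S. k y = m}" "x \<in> open_segment a b"
  obtain t where t: "0 < t" "t < 1" "x = (1 - t) *\<^sub>R a + t *\<^sub>R b"
    using x(2) by (auto simp: in_segment)
  \<comment> \<open>A sum of two nonnegative terms that is zero has both terms zero, and both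
    weights are positive.\<close>
  have "(1 - t) * (m - k a) + t * (m - k b) = 0"
  proof -
    have "m = (1 - t) * k a + t * k b"
      using x(1) unfolding t(3) by (simp add: blinfun.add_right blinfun.scaleR_right)
    then show ?thesis
      by (simp add: algebra_simps)
  qed
  moreover have "(1 - t) * (m - k a) \<ge> 0" "t * (m - k b) \<ge> 0"
    using t ab assms(2) by simp_all
  ultimately have "(1 - t) * (m - k a) = 0" "t * (m - k b) = 0"
    by linarith+
  then have "k a = m" "k b = m"
    using t by auto
  then show "a \<in> {y \<in> S. k y = m}" "b \<in> {y \<in> S. k y = m}"
    using ab by auto
qed auto

lemma compact_max_face:
  fixes k :: "'a::real_normed_vector \<Rightarrow>\<^sub>L real"
  assumes "compact S" "convex S" "S \<noteq> {}"
  obtains m where "{y \<in> S. k y = m} face_of S" "compact {y \<in> S. k y = m}" "{y \<in> S. k y = m} \<noteq> {}"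
    "\<And>y. y \<in> S \<Longrightarrow> k y \<le> m"
proof -
  have "continuous_on S (blinfun_apply k)"
    by (intro continuous_intros)
  then obtain x where x: "x \<in> S" "\<And>y. y \<in> S \<Longrightarrow> k y \<le> k x"
    using continuous_attains_sup[OF assms(1,3)] by blast
  have "closed {y. k y = k x}"
    by (intro closed_Collect_eq continuous_intros)
  then have "compact (S \<inter> {y. k y = k x})"
    using assms(1) by blast
  then have "compact {y \<in> S. k y = k x}"
    by (simp add: Int_def)
  with x show ?thesis
    by (intro that[of "k x"] face_of_functional_max[OF assms(2)]) auto
qed

text \<open>Each step passes to the face where the next functional is maximal. Functionals already
  made constant stay constant on smaller faces, and a face of a face is a face of the original set;
  hence the induction runs over arbitrary \<open>S\<close>.\<close>

lemma compact_face_constant_functionals: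
  fixes K :: "('a::real_normed_vector \<Rightarrow>\<^sub>L real) set"
  assumes "finite K" "compact S" "convex S" "S \<noteq> {}"
  shows "\<exists>T. T face_of S \<and> T \<noteq> {} \<and> (\<forall>k\<in>K. \<exists>c. \<forall>x\<in>T. k x = c)"
  using assms
proof (induction K arbitrary: S)
  case empty
  then show ?case by (auto intro: face_of_refl)
next
  case (insert k K)
  obtain m where m: "{y \<in> S. k y = m} face_of S" "compact {y \<in> S. k y = m}" "{y \<in> S. k y = m} \<noteq> {}"
    by (rule compact_max_face[OF insert.prems, of k])
  define T where "T = {y \<in> S. k y = m}"
  note T = T_def m[folded T_def]
  obtain U where U: "U face_of T" "U \<noteq> {}" "\<forall>k\<in>K. \<exists>c. \<forall>x\<in>U. k x = c"
    using insert.IH[OF T(3) face_of_imp_convex[OF T(2)] T(4)] by (elim exE conjE)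
  have "\<forall>k\<in>insert k K. \<exists>c. \<forall>x\<in>U. k x = c"
  proof -
    have "k x = m" if "x \<in> U" for x
      using that T(1) face_of_imp_subset[OF U(1)] by blast
    then show ?thesis
      using U(3) by blast
  qed
  with U(2) face_of_trans[OF U(1) T(2)] show ?case
    by (intro exI[of _ U] conjI)
qed

text \<open>
  Maximising \<open>k\<close> and then, lexicographically, a finite separating family of functionals
  leaves a face with a single point.
\<close>

lemma functional_max_at_extreme_point:
  fixes k :: "'a::real_normed_vector \<Rightarrow>\<^sub>L real"
  assumes "finite_dimensional_space TYPE('a)" "compact S" "convex S" "S \<noteq> {}"
  obtains e where "e extreme_point_of S" "\<And>x. x \<in> S \<Longrightarrow> k x \<le> k e"
proof -
  obtain K :: "('a \<Rightarrow>\<^sub>L real) set"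
    where K: "finite K" "\<And>x y. (\<And>k. k \<in> K \<Longrightarrow> k x = k y) \<Longrightarrow> x = y"
    using finite_dimensional_separating_functionals[OF assms(1)] by blast
  obtain m where m: "{y \<in> S. k y = m} face_of S" "compact {y \<in> S. k y = m}" "{y \<in> S. k y = m} \<noteq> {}"
    "\<And>y. y \<in> S \<Longrightarrow> k y \<le> m"
    using compact_max_face[OF assms(2-4), of k] by blast
  define T where "T = {y \<in> S. k y = m}"
  note T = T_def m(1-3)[folded T_def]
  obtain U where U: "U face_of T" "U \<noteq> {}" "\<forall>k\<in>K. \<exists>c. \<forall>x\<in>U. k x = c"
    using compact_face_constant_functionals[OF K(1) T(3) face_of_imp_convex[OF T(2)] T(4)]
    by (elim exE conjE)
  then obtain e where "e \<in> U" by blast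
  have "x = e" if "x \<in> U" for x
  proof (rule K(2))
    show "k x = k e" if "k \<in> K" for k
      using U(3) that \<open>x \<in> U\<close> \<open>e \<in> U\<close> by fastforce
  qed
  then have "U = {e}"
    using \<open>e \<in> U\<close> by blast
  then have "e extreme_point_of S"
    using face_of_trans[OF U(1) T(2)] by (simp add: face_of_singleton)
  moreover have "e \<in> T"
    using \<open>e \<in> U\<close> face_of_imp_subset[OF U(1)] by blast
  ultimately show ?thesis
    using m(4) T(1) by (intro that[of e]) auto
qed

section \<open>Functionals and the extreme points of the unit ball\<close>

text \<open>A one-sided bound suffices because the ball is symmetric: it is applied to a normalised
  vector and to its negative.\<close>

lemma blinfun_norm_le_1_iff:
  fixes h :: "'a::real_normed_vector \<Rightarrow>\<^sub>L real"
  shows "norm h \<le> 1 \<longleftrightarrow> (\<forall>x\<in>cball 0 1. h x \<le> 1)"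
proof
  assume "norm h \<le> 1"
  show "\<forall>x\<in>cball 0 1. h x \<le> 1"
  proof
    fix x :: 'a assume "x \<in> cball 0 1"
    then have "norm h * norm x \<le> 1"
      using \<open>norm h \<le> 1\<close> by (simp add: mult_le_one)
    then show "h x \<le> 1"
      using norm_blinfun[of h x] by simp
  qed
next
  assume h: "\<forall>x\<in>cball 0 1. h x \<le> 1"
  show "norm h \<le> 1"
  proof (rule norm_blinfun_bound)
    fix x :: 'a
    show "norm (h x) \<le> 1 * norm x"
    proof (cases "x = 0")
      case False
      have "h (x /\<^sub>R norm x) \<le> 1" "h (- (x /\<^sub>R norm x)) \<le> 1"
        using h False by auto
      then show ?thesis
        using False by (simp add: blinfun.scaleR_right blinfun.minus_right field_simps abs_le_iff)
    qed simp
  qed simp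
qed

text \<open>The maximum of \<open>h\<close> over the compact ball is attained at an extreme
  point.\<close>

lemma blinfun_norm_le_1_extreme_points:
  fixes h :: "'a::real_normed_vector \<Rightarrow>\<^sub>L real"
  assumes "finite_dimensional_space TYPE('a)"
    and "\<And>e. e extreme_point_of cball (0::'a) 1 \<Longrightarrow> h e \<le> 1"
  shows "norm h \<le> 1"
proof -
  have "cball (0::'a) 1 \<noteq> {}"
    by simp
  then obtain e where e: "e extreme_point_of cball (0::'a) 1" "\<And>x. x \<in> cball 0 1 \<Longrightarrow> h x \<le> h e"
    using functional_max_at_extreme_point[OF assms(1) finite_dimensional_compact_cball[OF assms(1)]
        convex_cball] by blast
  show ?thesis
    unfolding blinfun_norm_le_1_iff
  proof
    show "h x \<le> 1" if "x \<in> cball 0 1" for x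
      using e(2)[OF that] assms(2)[OF e(1)] by linarith
  qed
qed

text \<open>By homogeneity the maximum of \<open>g\<close> over the closed ball bounds
  \<open>norm g\<close>, and this forces a maximiser to have norm 1.\<close>

lemma norm_attained:
  fixes g :: "'a::real_normed_vector \<Rightarrow>\<^sub>L real"
  assumes "finite_dimensional_space TYPE('a)" "norm g = 1"
  obtains x where "x \<in> sphere 0 1" "g x = 1"
proof -
  have "continuous_on (cball 0 1) (blinfun_apply g)"
    by (intro continuous_intros)
  then obtain x where x: "x \<in> cball 0 1" "\<And>y. y \<in> cball 0 1 \<Longrightarrow> g y \<le> g x"
    using continuous_attains_sup[OF finite_dimensional_compact_cball[OF assms(1)], of g] by auto
  have "norm g \<le> g x"
  proof (rule norm_blinfun_bound)
    show "0 \<le> g x"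
      using x(2)[of 0] by simp
    show "norm (g y) \<le> g x * norm y" for y
    proof (cases "y = 0")
      case False
      have "g (y /\<^sub>R norm y) \<le> g x" "g (- (y /\<^sub>R norm y)) \<le> g x"
        using x(2) False by auto
      then show ?thesis
        using False by (simp add: blinfun.scaleR_right blinfun.minus_right field_simps abs_le_iff)
    qed simp
  qed
  moreover have "g x \<le> norm x"
    using norm_blinfun[of g x] assms(2) by simp
  moreover have "norm x \<le> 1"
    using x(1) by simp
  ultimately have "norm x = 1" "g x = 1"
    using assms(2) by linarith+
  then show ?thesis
    by (intro that[of x]) simp_all
qed

text \<open>Splits the set into two opposite faces of the ball, so that facts about faces can be
  applied to \<open>g\<close> and to \<open>- g\<close>. The sphere may be replaced by the ball
  since \<open>\<bar>g x\<bar> = 1\<close> already forces \<open>norm x \<ge> 1\<close>.\<close>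

lemma norm_attainment_set_unit:
  assumes "norm g = 1"
  shows "norm_attainment_set g = {x \<in> cball 0 1. g x = 1} \<union> {x \<in> cball 0 1. (- g) x = 1}"
proof -
  have "norm x = 1" if "norm x \<le> 1" "\<bar>g x\<bar> = 1" for x
  proof -
    have "1 \<le> norm x"
      using norm_blinfun[of g x] unfolding real_norm_def assms that(2) mult_1 .
    then show ?thesis
      using that(1) by linarith
  qed
  then have "norm_attainment_set g = {x \<in> cball 0 1. \<bar>g x\<bar> = 1}"
    unfolding norm_attainment_set_def assms by auto
  also have "\<dots> = {x \<in> cball 0 1. g x = 1} \<union> {x \<in> cball 0 1. (- g) x = 1}"
    unfolding blinfun.minus_left by (auto simp: abs_if)
  finally show ?thesis .
qed

text \<open>The minimum of \<open>k\<close> over the face of \<open>g\<close> is attained at an extreme point of the ball.\<close>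

lemma norming_face_mono:
  fixes g k :: "'a::real_normed_vector \<Rightarrow>\<^sub>L real"
  assumes "finite_dimensional_space TYPE('a)" "norm g = 1" "norm k = 1"
    and "\<And>e. e extreme_point_of cball 0 1 \<Longrightarrow> g e = 1 \<Longrightarrow> k e = 1"
  shows "{x \<in> cball 0 1. g x = 1} \<subseteq> {x \<in> cball 0 1. k x = 1}"
proof
  fix x assume x: "x \<in> {x \<in> cball 0 1. g x = 1}"
  let ?F = "{x \<in> cball 0 1. g x = 1}"
  have face: "?F face_of cball 0 1"
  proof (rule face_of_functional_max[OF convex_cball])
    show "g y \<le> 1" if "y \<in> cball 0 1" for y
      using blinfun_norm_le_1_iff[of g] assms(2) that by simp
  qed
  have "closed {x. g x = 1}"
    by (intro closed_Collect_eq continuous_intros)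
  then have "compact (cball 0 1 \<inter> {x. g x = 1})"
    using finite_dimensional_compact_cball[OF assms(1)] by blast
  then have "compact ?F"
    by (simp add: Int_def)
  then obtain e where e: "e extreme_point_of ?F" "\<And>x. x \<in> ?F \<Longrightarrow> (- k) x \<le> (- k) e"
    using functional_max_at_extreme_point[OF assms(1) _ face_of_imp_convex[OF face], of "- k"] x
    by blast
  have "e extreme_point_of cball 0 1"
    using face_of_trans[OF _ face] e(1) by (simp flip: face_of_singleton)
  moreover have "g e = 1"
    using e(1) by (simp add: extreme_point_of_def)
  ultimately have "1 \<le> k x"
    using assms(4) e(2)[OF x] by (simp add: blinfun.minus_left)
  moreover have "k x \<le> 1"
    using x assms(3) blinfun_norm_le_1_iff[of k] by simp
  ultimately show "x \<in> {x \<in> cball 0 1. k x = 1}"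
    using x by simp
qed

text \<open>By \<open>norming_face_mono\<close> in both directions, such a face is determined by the
  extreme points of the ball that it contains, and there are only finitely many sets of
  these.\<close>

lemma finite_norming_faces:
  assumes "finite_dimensional_space TYPE('a::real_normed_vector)" "polyhedral_space TYPE('a)"
  shows "finite ((\<lambda>g :: 'a \<Rightarrow>\<^sub>L real. {x \<in> cball 0 1. g x = 1}) ` sphere 0 1)"
proof -
  let ?E = "{x :: 'a. x extreme_point_of cball 0 1}"
  let ?F = "\<lambda>g :: 'a \<Rightarrow>\<^sub>L real. {x \<in> cball 0 1. g x = 1}"
  have "finite (Pow ?E)"
    using assms(2) by (simp add: polyhedral_space_def)
  then have "finite ((\<lambda>A. A \<inter> ?E) ` ?F ` sphere 0 1)"
    by (rule rev_finite_subset) auto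
  moreover have "inj_on (\<lambda>A. A \<inter> ?E) (?F ` sphere 0 1)"
  proof (intro inj_onI, elim imageE)
    fix A B g k
    assume eq: "A \<inter> ?E = B \<inter> ?E" and *: "A = ?F g" "B = ?F k" "g \<in> sphere 0 1" "k \<in> sphere 0 1"
    have "g e = 1 \<longleftrightarrow> k e = 1" if "e extreme_point_of cball 0 1" for e
      using eq that * by (auto simp: extreme_point_of_def set_eq_iff)
    then show "A = B"
      using norming_face_mono[OF assms(1), of g k] norming_face_mono[OF assms(1), of k g] *
      by auto
  qed
  ultimately show ?thesis
    by (rule finite_imageD)
qed

text \<open>The radius \<open>d\<close> is uniform in \<open>g\<close>: the faces missing
  \<open>v\<close> are finitely many closed sets, so their union \<open>?C\<close> is closed and
  stays at positive distance from \<open>v\<close>.\<close>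

lemma norm_attainment_set_gap:
  fixes v :: "'a::real_normed_vector"
  assumes "finite_dimensional_space TYPE('a)" "polyhedral_space TYPE('a)"
  obtains d where "d > 0"
    "\<And>g u. norm g = 1 \<Longrightarrow> u \<in> norm_attainment_set g \<Longrightarrow> norm (u - v) < d \<Longrightarrow> v \<in> norm_attainment_set g"
proof -
  let ?F = "\<lambda>g :: 'a \<Rightarrow>\<^sub>L real. {x \<in> cball 0 1. g x = 1}"
  let ?C = "\<Union>{A \<in> ?F ` sphere 0 1. v \<notin> A}"
  have closed_F: "closed (?F g)" for g
  proof -
    have "closed (cball 0 1 \<inter> {x. g x = 1})"
      by (intro closed_Int closed_cball closed_Collect_eq continuous_intros)
    then show ?thesis
      by (simp add: Int_def)
  qed
  have "finite {A \<in> ?F ` sphere 0 1. v \<notin> A}"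
    using finite_norming_faces[OF assms] by (rule rev_finite_subset) blast
  then have "closed ?C"
    by (rule closed_Union) (use closed_F in blast)
  then obtain d where d: "d > 0" "\<And>x. x \<in> ?C \<Longrightarrow> d \<le> dist v x"
    using closed_imp_pos_dist[of ?C v] by blast
  have F: "v \<in> ?F g" if "norm g = 1" "u \<in> ?F g" "norm (u - v) < d" for g u
  proof (rule ccontr)
    assume "v \<notin> ?F g"
    then have "?F g \<in> {A \<in> ?F ` sphere 0 1. v \<notin> A}"
      using that(1) by simp
    then have "u \<in> ?C"
      using that(2) by blast
    then show False
      using d(2) that(3) by (force simp: dist_norm norm_minus_commute)
  qed
  show ?thesis
  proof (rule that[OF d(1)])
    fix g u
    assume "norm g = 1" "u \<in> norm_attainment_set g" "norm (u - v) < d"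
    then show "v \<in> norm_attainment_set g"
      using F[of g u] F[of "- g" u] by (auto simp: norm_attainment_set_unit)
  qed
qed

section \<open>Extreme functionals\<close>

lemma extreme_contraction_determined:
  fixes f g :: "'a::real_normed_vector \<Rightarrow>\<^sub>L real"
  assumes "finite_dimensional_space TYPE('a)" "polyhedral_space TYPE('a)"
    and "extreme_contraction f" "norm g \<le> 1"
    and eq: "\<And>e. e extreme_point_of cball 0 1 \<Longrightarrow> \<bar>f e\<bar> = 1 \<Longrightarrow> g e = f e"
  shows "g = f"
proof (rule ccontr)
  assume "g \<noteq> f"
  let ?E = "{x :: 'a. x extreme_point_of cball 0 1}"
  have nf: "norm f \<le> 1"
    using assms(3) by (simp add: extreme_contraction_def extreme_point_of_def)
  have le1: "\<bar>h e\<bar> \<le> 1" if "norm h \<le> 1" "e \<in> ?E" for h :: "'a \<Rightarrow>\<^sub>L real" and e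
  proof -
    have "norm e \<le> 1"
      using that(2) by (simp add: extreme_point_of_def)
    then have "norm h * norm e \<le> 1"
      using that(1) by (simp add: mult_le_one)
    then show ?thesis
      using norm_blinfun[of h e] by simp
  qed
  \<comment> \<open>At an extreme point \<open>e\<close> the values of \<open>f\<close> and
    \<open>g\<close> differ by at most 2, so a move by \<open>t\<close> times the difference uses at
    most the slack \<open>1 - \<bar>f e\<bar>\<close>. The inserted 1 keeps the minimum defined if
    no point has slack.\<close>
  define t where "t = Min (insert 1 ((\<lambda>e. (1 - \<bar>f e\<bar>) / 2) ` {e \<in> ?E. \<bar>f e\<bar> < 1}))"
  have fin: "finite {e \<in> ?E. \<bar>f e\<bar> < 1}"
    using assms(2) by (simp add: polyhedral_space_def)
  have "t > 0"
    unfolding t_def using fin by (subst Min_gr_iff) auto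
  have t: "t \<le> (1 - \<bar>f e\<bar>) / 2" if "e \<in> ?E" "\<bar>f e\<bar> < 1" for e
    unfolding t_def using fin that by (intro Min_le) auto
  have bound: "norm (f + s *\<^sub>R (g - f)) \<le> 1" if s: "\<bar>s\<bar> = t" for s
  proof (rule blinfun_norm_le_1_extreme_points[OF assms(1)])
    fix e :: 'a assume e: "e extreme_point_of cball 0 1"
    show "(f + s *\<^sub>R (g - f)) e \<le> 1"
    proof (cases "\<bar>f e\<bar> = 1")
      case True
      then show ?thesis
        using eq[OF e] by (simp add: blinfun.add_left blinfun.scaleR_left blinfun.diff_left)
    next
      case False
      then have lt: "\<bar>f e\<bar> < 1"
        using le1[OF nf, of e] e by simp
      have "\<bar>s * (g e - f e)\<bar> \<le> t * 2"
        unfolding abs_mult s using le1[OF nf, of e] le1[OF assms(4), of e] e \<open>t > 0\<close>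
        by (intro mult_left_mono) auto
      then have "f e + s * (g e - f e) \<le> 1"
        using t[of e] e lt by auto
      then show ?thesis
        by (simp add: blinfun.add_left blinfun.scaleR_left blinfun.diff_left)
    qed
  qed
  define w where "w = t *\<^sub>R (g - f)"
  have "w \<noteq> 0"
    using \<open>g \<noteq> f\<close> \<open>t > 0\<close> by (simp add: w_def)
  have "f - w \<in> cball 0 1" "f + w \<in> cball 0 1"
    using bound[of "- t"] bound[of t] \<open>t > 0\<close> by (simp_all add: w_def)
  moreover have "f \<in> open_segment (f - w) (f + w)"
  proof -
    have "f = (1 - 1/2) *\<^sub>R (f - w) + (1/2) *\<^sub>R (f + w)"
      unfolding scaleR_add_right scaleR_diff_right by (simp flip: scaleR_add_left)
    moreover have "f - w \<noteq> f + w"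
    proof
      assume "f - w = f + w"
      then have "2 *\<^sub>R w = 0"
        by (simp add: scaleR_2 diff_eq_eq add.assoc)
      then show False
        using \<open>w \<noteq> 0\<close> by simp
    qed
    ultimately show ?thesis
      unfolding in_segment by (intro conjI exI[of _ "1/2"]) auto
  qed
  ultimately show False
    using assms(3) unfolding extreme_contraction_def extreme_point_of_def by blast
qed

text \<open>\<open>?s\<close> records the sign pattern of a functional on \<open>?E\<close>.
  Agreement of the patterns gives agreement wherever one of the functionals has modulus 1, which is
  what \<open>extreme_contraction_determined\<close> asks for.\<close>

lemma finite_extreme_contractions:
  assumes "finite_dimensional_space TYPE('a::real_normed_vector)" "polyhedral_space TYPE('a)"
  shows "finite {g :: 'a \<Rightarrow>\<^sub>L real. extreme_contraction g}"
proof -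
  let ?E = "{x :: 'a. x extreme_point_of cball 0 1}"
  let ?s = "\<lambda>g :: 'a \<Rightarrow>\<^sub>L real. ({e \<in> ?E. g e = 1}, {e \<in> ?E. g e = - 1})"
  have "finite (Pow ?E \<times> Pow ?E)"
    using assms(2) by (simp add: polyhedral_space_def)
  then have "finite (?s ` {g. extreme_contraction g})"
    by (rule rev_finite_subset) auto
  moreover have "inj_on ?s {g. extreme_contraction g}"
  proof (rule inj_onI)
    fix g k assume gk: "g \<in> {g. extreme_contraction g}" "k \<in> {g. extreme_contraction g}" "?s g = ?s k"
    show "g = k"
    proof (rule extreme_contraction_determined[OF assms])
      show "extreme_contraction k" "norm g \<le> 1"
        using gk by (auto simp: extreme_contraction_def extreme_point_of_def)
      show "g e = k e" if "e extreme_point_of cball 0 1" "\<bar>k e\<bar> = 1" for e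
      proof -
        have "g e = 1 \<longleftrightarrow> k e = 1" "g e = - 1 \<longleftrightarrow> k e = - 1"
          using gk(3) that(1) by auto
        then show ?thesis
          using that(2) by (auto simp: abs_if split: if_splits)
      qed
    qed
  qed
  ultimately show ?thesis
    by (rule finite_imageD)
qed

section \<open>Uniform BPB approximations and the equivalences\<close>

text \<open>The unit vectors at distance at least \<open>\<epsilon>\<close> from every norming point
  form a compact set \<open>C\<close>. There \<open>\<bar>f x\<bar>\<close> attains a maximum below
  1, and the gap to 1 is the required \<open>\<delta>\<close>; if \<open>C\<close> is empty, 1 will
  do.\<close>

lemma uniform_BPB_approximation_self:
  fixes f :: "'a::real_normed_vector \<Rightarrow>\<^sub>L real"
  assumes "finite_dimensional_space TYPE('a)" "norm f = 1" "\<epsilon> > 0"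
  shows "uniform_BPB_approximation \<epsilon> f f"
proof -
  define C where "C = {x \<in> sphere 0 1. \<forall>u\<in>norm_attainment_set f. \<epsilon> \<le> norm (u - x)}"
  have "\<exists>\<delta>>0. \<forall>x\<in>C. \<bar>f x\<bar> \<le> 1 - \<delta>"
  proof (cases "C = {}")
    case True
    then show ?thesis by (auto intro: exI[of _ 1])
  next
    case False
    have "closed ({x. norm x = 1} \<inter> (\<Inter>u\<in>norm_attainment_set f. {x. \<epsilon> \<le> norm (u - x)}))"
      by (intro closed_Int closed_Collect_eq closed_INT ballI closed_Collect_le continuous_intros)
    also have "{x. norm x = 1} \<inter> (\<Inter>u\<in>norm_attainment_set f. {x. \<epsilon> \<le> norm (u - x)}) = C"
      unfolding C_def by auto
    finally have "closed C" .
    moreover have "C \<subseteq> cball 0 1"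
      by (auto simp: C_def)
    ultimately have "compact C"
      using compact_Int_closed[OF finite_dimensional_compact_cball[OF assms(1)], of C]
      by (simp add: Int_absorb1)
    moreover have "continuous_on C (\<lambda>x. \<bar>f x\<bar>)"
      by (intro continuous_intros)
    ultimately obtain x where x: "x \<in> C" "\<And>y. y \<in> C \<Longrightarrow> \<bar>f y\<bar> \<le> \<bar>f x\<bar>"
      using continuous_attains_sup[of C "\<lambda>x. \<bar>f x\<bar>"] False by blast
    have "x \<notin> norm_attainment_set f"
      using x(1) assms(3) by (force simp: C_def)
    moreover have "\<bar>f x\<bar> \<le> 1"
      using norm_blinfun[of f x] x(1) assms(2) by (simp add: C_def)
    ultimately have "\<bar>f x\<bar> < 1"
      using x(1) assms(2) by (auto simp: C_def norm_attainment_set_def)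
    then show ?thesis
      using x(2) by (intro exI[of _ "1 - \<bar>f x\<bar>"]) auto
  qed
  then obtain \<delta> where \<delta>: "\<delta> > 0" "\<And>x. x \<in> C \<Longrightarrow> \<bar>f x\<bar> \<le> 1 - \<delta>"
    by blast
  have "\<exists>u\<in>norm_attainment_set f. norm (u - x) < \<epsilon>" if "x \<in> sphere 0 1" "\<bar>f x\<bar> > 1 - \<delta>" for x
    using \<delta>(2)[of x] that by (force simp: C_def)
  then have "\<exists>\<delta>>0. \<forall>x\<in>sphere 0 1. \<bar>f x\<bar> > 1 - \<delta> \<longrightarrow>
      (\<exists>u\<in>norm_attainment_set f. norm (u - x) < \<epsilon>)"
    using \<delta>(1) by blast
  moreover have "f \<in> sphere 0 1" "norm (f - f) < \<epsilon>"
    using assms(2,3) by simp_all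
  ultimately show ?thesis
    unfolding uniform_BPB_approximation_def by (intro conjI)
qed

lemma extreme_imp_no_nontrivial_BPB:
  fixes f :: "'a::real_normed_vector \<Rightarrow>\<^sub>L real"
  assumes "finite_dimensional_space TYPE('a)" "polyhedral_space TYPE('a)"
    and "norm f = 1" "extreme_contraction f"
  shows "\<exists>\<epsilon>\<^sub>0>0. \<forall>\<epsilon>. 0 < \<epsilon> \<and> \<epsilon> < \<epsilon>\<^sub>0 \<longrightarrow>
           \<not> (\<exists>g. nontrivial_uniform_BPB_approximation \<epsilon> f g)"
proof -
  let ?E = "{x :: 'a. x extreme_point_of cball 0 1}"
  have "\<exists>d>0. \<forall>g u. norm g = 1 \<longrightarrow> u \<in> norm_attainment_set g \<longrightarrow> norm (u - v) < d
      \<longrightarrow> v \<in> norm_attainment_set g" for v :: 'a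
    by (rule norm_attainment_set_gap[OF assms(1,2), of v]) blast
  then obtain d :: "'a \<Rightarrow> real" where "\<forall>v. d v > 0 \<and>
      (\<forall>g u. norm g = 1 \<longrightarrow> u \<in> norm_attainment_set g \<longrightarrow> norm (u - v) < d v
        \<longrightarrow> v \<in> norm_attainment_set g)"
    using choice[of "\<lambda>v d. d > 0 \<and> (\<forall>g u. norm g = 1 \<longrightarrow> u \<in> norm_attainment_set g
        \<longrightarrow> norm (u - v) < d \<longrightarrow> v \<in> norm_attainment_set g)"] by blast
  then have d: "\<And>v. d v > 0"
    "\<And>v g u. norm g = 1 \<Longrightarrow> u \<in> norm_attainment_set g \<Longrightarrow> norm (u - v) < d v
      \<Longrightarrow> v \<in> norm_attainment_set g"
    by blast+
  \<comment> \<open>The gaps \<open>d e\<close> force each extreme point normed by \<open>f\<close>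
    to be normed by \<open>g\<close>. The cap 1 then excludes opposite signs, since these would make
    \<open>f e\<close> and \<open>g e\<close> differ by 2.\<close>
  define \<epsilon>0 where "\<epsilon>0 = Min (insert 1 (d ` ?E))"
  have fin: "finite ?E"
    using assms(2) by (simp add: polyhedral_space_def)
  have pos: "\<epsilon>0 > 0"
    unfolding \<epsilon>0_def using fin d(1) by (subst Min_gr_iff) auto
  have le: "\<epsilon>0 \<le> d e" if "e \<in> ?E" for e
    unfolding \<epsilon>0_def using fin that by (intro Min_le) auto
  have le1: "\<epsilon>0 \<le> 1"
    unfolding \<epsilon>0_def using fin by (intro Min_le) auto
  have "g = f" if \<epsilon>: "0 < \<epsilon>" "\<epsilon> < \<epsilon>0" and g: "uniform_BPB_approximation \<epsilon> f g" for \<epsilon> g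
  proof (rule extreme_contraction_determined[OF assms(1,2,4)])
    have ng: "norm g = 1" and fg: "norm (f - g) < \<epsilon>"
      using g by (auto simp: uniform_BPB_approximation_def)
    then show "norm g \<le> 1" by simp
    fix e :: 'a assume e: "e extreme_point_of cball 0 1" "\<bar>f e\<bar> = 1"
    have "norm e \<le> 1"
      using e(1) by (simp add: extreme_point_of_def)
    moreover have "1 \<le> norm e"
      using norm_blinfun[of f e] e(2) assms(3) by simp
    ultimately have ne: "norm e = 1"
      by simp
    obtain \<delta> where \<delta>: "\<delta> > 0" "\<forall>x\<in>sphere 0 1. \<bar>f x\<bar> > 1 - \<delta> \<longrightarrow>
        (\<exists>u\<in>norm_attainment_set g. norm (u - x) < \<epsilon>)"
      using g unfolding uniform_BPB_approximation_def by (elim conjE exE)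
    have "e \<in> sphere 0 1" "\<bar>f e\<bar> > 1 - \<delta>"
      using ne e(2) \<delta>(1) by simp_all
    then obtain u where u: "u \<in> norm_attainment_set g" "norm (u - e) < \<epsilon>"
      using \<delta>(2) by blast
    then have "e \<in> norm_attainment_set g"
      using d(2)[OF ng, of u e] le[of e] e(1) \<epsilon>(2) by simp
    then have "\<bar>g e\<bar> = 1"
      by (simp add: norm_attainment_set_def ng)
    moreover have "\<bar>f e - g e\<bar> < 1"
      using norm_blinfun[of "f - g" e] ne fg \<epsilon>(2) le1 by (simp add: blinfun.diff_left)
    ultimately show "g e = f e"
      using e(2) by linarith
  qed
  then show ?thesis
    using pos unfolding nontrivial_uniform_BPB_approximation_def by blast
qed

lemma not_extreme_imp_nontrivial_BPB:
  fixes f :: "'a::real_normed_vector \<Rightarrow>\<^sub>L real"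
  assumes "finite_dimensional_space TYPE('a)" "norm f = 1" "\<not> extreme_contraction f" "\<epsilon> > 0"
  shows "\<exists>g. nontrivial_uniform_BPB_approximation \<epsilon> f g"
proof -
  obtain a b where ab: "norm a \<le> 1" "norm b \<le> 1" "f \<in> open_segment a b"
    using assms(2,3) by (auto simp: extreme_contraction_def extreme_point_of_def)
  obtain t where t: "0 < t" "t < 1" "f = (1 - t) *\<^sub>R a + t *\<^sub>R b"
    using ab(3) by (auto simp: in_segment)
  have "f \<noteq> b"
    using ab(3) by (auto simp: open_segment_def)
  \<comment> \<open>The bound 1/2 makes \<open>g\<close> a proper convex combination of
    \<open>f\<close> and \<open>b\<close>; the other bound gives
    \<open>norm (f - g) \<le> \<epsilon> / 2\<close>.\<close>
  define s where "s = min (1/2) (\<epsilon> / (2 * norm (b - f)))"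
  have s: "0 < s" "s < 1"
    using assms(4) \<open>f \<noteq> b\<close> by (auto simp: s_def)
  define g where "g = (1 - s) *\<^sub>R f + s *\<^sub>R b"
  have g_eq: "g = f + s *\<^sub>R (b - f)"
    by (simp add: g_def algebra_simps)
  have "g \<noteq> f"
    using s \<open>f \<noteq> b\<close> by (simp add: g_eq)
  have "norm (f - g) = s * norm (b - f)"
    using s by (simp add: g_eq)
  also have "\<dots> \<le> \<epsilon> / (2 * norm (b - f)) * norm (b - f)"
    by (intro mult_right_mono) (auto simp: s_def)
  also have "\<dots> = \<epsilon> / 2"
    using \<open>f \<noteq> b\<close> by simp
  finally have close: "norm (f - g) < \<epsilon>"
    using assms(4) by linarith
  have "norm g \<le> (1 - s) * 1 + s * 1"
    unfolding g_def using s ab assms(2)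
    by (intro norm_triangle_le add_mono) (auto intro: mult_left_le)
  then have ng_le: "norm g \<le> 1"
    by simp
  have agree: "g x = f x" if x: "norm x = 1" "\<bar>f x\<bar> = 1" for x
  proof -
    have bounds: "\<bar>a x\<bar> \<le> 1" "\<bar>b x\<bar> \<le> 1"
      using norm_blinfun[of a x] norm_blinfun[of b x] ab x(1) by auto
    have "f x = (1 - t) * a x + t * b x"
      by (simp add: t(3) blinfun.add_left blinfun.scaleR_left)
    then have sum0: "(1 - t) * (f x - a x) + t * (f x - b x) = 0"
      by (simp add: algebra_simps)
    \<comment> \<open>Since \<open>f x\<close> is an endpoint of [-1,1], the two summands in
      \<open>sum0\<close> have the same sign, so both vanish.\<close>
    have "t * (f x - b x) = 0"
    proof (cases "f x = 1")
      case True
      have "(1 - t) * (f x - a x) \<ge> 0" "t * (f x - b x) \<ge> 0"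
        using t(1,2) bounds True by (auto intro!: mult_nonneg_nonneg)
      with sum0 show ?thesis by linarith
    next
      case False
      then have "f x = - 1"
        using x(2) by linarith
      then have "(1 - t) * (f x - a x) \<le> 0" "t * (f x - b x) \<le> 0"
        using t(1,2) bounds by (auto intro!: mult_nonneg_nonpos)
      with sum0 show ?thesis by linarith
    qed
    then have "b x = f x"
      using t by simp
    then show ?thesis
      by (simp add: g_eq blinfun.add_left blinfun.scaleR_left blinfun.diff_left)
  qed
  \<comment> \<open>A point where \<open>f\<close> attains its norm shows that \<open>g\<close>,
    which agrees with \<open>f\<close> there, has norm at least 1.\<close>
  obtain x where "norm x = 1" "f x = 1"
    using norm_attained[OF assms(1,2)] by auto
  then have "1 \<le> norm g"
    using agree[of x] norm_blinfun[of g x] by simp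
  with ng_le have ng: "norm g = 1"
    by simp
  have mono: "norm_attainment_set f \<subseteq> norm_attainment_set g"
    using agree ng assms(2) by (auto simp: norm_attainment_set_def)
  \<comment> \<open>The \<open>\<delta>\<close> that works for \<open>f\<close> as its own
    approximation also works for \<open>g\<close>, because every norming point of \<open>f\<close>
    is one of \<open>g\<close>.\<close>
  obtain \<delta> where \<delta>: "\<delta> > 0" "\<forall>x\<in>sphere 0 1. \<bar>f x\<bar> > 1 - \<delta> \<longrightarrow>
      (\<exists>u\<in>norm_attainment_set f. norm (u - x) < \<epsilon>)"
    using uniform_BPB_approximation_self[OF assms(1,2,4)]
    unfolding uniform_BPB_approximation_def by (elim conjE exE)
  have "uniform_BPB_approximation \<epsilon> f g"
    unfolding uniform_BPB_approximation_def
  proof (intro conjI exI[of _ \<delta>] ballI impI)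
    show "\<exists>u\<in>norm_attainment_set g. norm (u - x) < \<epsilon>"
      if "x \<in> sphere 0 1" "\<bar>f x\<bar> > 1 - \<delta>" for x
      using \<delta>(2) mono that by blast
  qed (use ng close \<delta>(1) in simp_all)
  with \<open>g \<noteq> f\<close> show ?thesis
    unfolding nontrivial_uniform_BPB_approximation_def by blast
qed

text \<open>The extreme functionals form a finite, hence closed, set, and \<open>f\<close> lies in
  its closure.\<close>

lemma limit_of_extreme_contractions:
  fixes f :: "'a::real_normed_vector \<Rightarrow>\<^sub>L real"
  assumes "finite_dimensional_space TYPE('a)" "polyhedral_space TYPE('a)"
    and "\<And>\<epsilon>. \<epsilon> > 0 \<Longrightarrow> \<exists>g. norm (f - g) < \<epsilon> \<and> extreme_contraction g"
  shows "extreme_contraction f"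
proof -
  have "closed {g :: 'a \<Rightarrow>\<^sub>L real. extreme_contraction g}"
    using finite_extreme_contractions[OF assms(1,2)] by (rule finite_imp_closed)
  moreover have "f \<in> closure {g. extreme_contraction g}"
    using assms(3) by (auto simp: closure_approachable dist_norm norm_minus_commute)
  ultimately show ?thesis
    by (metis closure_closed mem_Collect_eq)
qed

theorem theorem3p6:
  fixes f :: "'a::banach \<Rightarrow>\<^sub>L real"
  assumes "finite_dimensional_space TYPE('a)"
    and "polyhedral_space TYPE('a)"
    and "f \<in> sphere 0 1"
  shows "(extreme_contraction f \<longleftrightarrow>
            (\<exists>\<epsilon>\<^sub>0>0. \<forall>\<epsilon>. 0 < \<epsilon> \<and> \<epsilon> < \<epsilon>\<^sub>0 \<longrightarrow>
               \<not> (\<exists>g. nontrivial_uniform_BPB_approximation \<epsilon> f g)))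
       \<and> (extreme_contraction f \<longleftrightarrow>
            (\<forall>\<epsilon>>0. \<exists>g. uniform_BPB_approximation \<epsilon> f g \<and> extreme_contraction g))"
proof (intro conjI iffI)
  have nf: "norm f = 1"
    using assms(3) by simp
  show "\<exists>\<epsilon>\<^sub>0>0. \<forall>\<epsilon>. 0 < \<epsilon> \<and> \<epsilon> < \<epsilon>\<^sub>0 \<longrightarrow>
      \<not> (\<exists>g. nontrivial_uniform_BPB_approximation \<epsilon> f g)" if "extreme_contraction f"
    using extreme_imp_no_nontrivial_BPB[OF assms(1,2) nf that] .
  show "extreme_contraction f" if no_approx: "\<exists>\<epsilon>\<^sub>0>0. \<forall>\<epsilon>. 0 < \<epsilon> \<and> \<epsilon> < \<epsilon>\<^sub>0 \<longrightarrow>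
      \<not> (\<exists>g. nontrivial_uniform_BPB_approximation \<epsilon> f g)"
  proof (rule ccontr)
    assume "\<not> extreme_contraction f"
    then have ex: "\<exists>g. nontrivial_uniform_BPB_approximation \<epsilon> f g" if "\<epsilon> > 0" for \<epsilon>
      using not_extreme_imp_nontrivial_BPB[OF assms(1) nf] that by blast
    obtain \<epsilon>0 where "\<epsilon>0 > 0" "\<forall>\<epsilon>. 0 < \<epsilon> \<and> \<epsilon> < \<epsilon>0 \<longrightarrow>
        \<not> (\<exists>g. nontrivial_uniform_BPB_approximation \<epsilon> f g)"
      using no_approx by (elim exE conjE)
    moreover obtain \<epsilon> where "0 < \<epsilon>" "\<epsilon> < \<epsilon>0"
      using dense[OF \<open>\<epsilon>0 > 0\<close>] by blast
    ultimately show False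
      using ex by blast
  qed
  \<comment> \<open>The witness is \<open>f\<close> itself.\<close>
  show "\<forall>\<epsilon>>0. \<exists>g. uniform_BPB_approximation \<epsilon> f g \<and> extreme_contraction g"
    if "extreme_contraction f"
    using uniform_BPB_approximation_self[OF assms(1) nf] that by blast
  show "extreme_contraction f"
    if approx: "\<forall>\<epsilon>>0. \<exists>g. uniform_BPB_approximation \<epsilon> f g \<and> extreme_contraction g"
  proof (rule limit_of_extreme_contractions[OF assms(1,2)])
    fix \<epsilon> :: real assume "\<epsilon> > 0"
    then obtain g where "uniform_BPB_approximation \<epsilon> f g" "extreme_contraction g"
      using approx by blast
    then show "\<exists>g. norm (f - g) < \<epsilon> \<and> extreme_contraction g"
      unfolding uniform_BPB_approximation_def by blast
  qed
qed

end
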